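(* Let $\mathcal{T}$ be the density topology on $\mathbf{R}$. Then the space $(\mathbf{R},\mathcal{T})$ is not semi-stratifiable, and a subset $A \subseteq \mathbf{R}$ is stratifiable in the subspace topology inherited from $(\mathbf{R},\mathcal{T})$ if and only if $A$ is a closed and discrete subset of $(\mathbf{R},\mathcal{T})$.
   Context: Density topology: let $m$ denote Lebesgue measure. A Lebesgue measurable set $E \subseteq \mathbf{R}$ has density $d$ at $x \in \mathbf{R}$ if $\lim_{h \to 0^+} \frac{m(E \cap [x-h,x+h])}{2h}$ exists and equals $d$. Let $\phi(E)$ be the set of $x\in\mathbf{R}$ at which $E$ has density $1$. The open sets of the density topology $\mathcal{T}$ on $\mathbf{R}$ are the measurable sets $E$ with $E \subseteq \phi(E)$. A topological space $X$ is semi-stratifiable if to each open set $U \subseteq X$ one can assign a sequence $(U_n)_{n\in\mathbf{N}}$ of closed subsets of $X$ such that $U = \bigcup_n U_n$, and $U_n \subseteq V_n$ for all $n$ whenever $U \subseteq V$ are open. A ($T_1$) space $X$ is stratifiable if such an assignment can be chosen with, in addition, $U = \bigcup_n \mathrm{int}(U_n)$ for every open $U$. A subset is closed and discrete if it is closed in $(\mathbf{R},\mathcal{T})$ and its subspace topology is discrete. *)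

theory Defs
  imports "HOL-Analysis.Analysis"
begin

section \<open>The density topology on the real line\<close>

definition has_density :: "real set \<Rightarrow> real \<Rightarrow> real \<Rightarrow> bool" where
  "has_density E d x \<longleftrightarrow>
     ((\<lambda>h. measure lebesgue (E \<inter> {x - h..x + h}) / (2 * h)) \<longlongrightarrow> d) (at_right 0)"

definition density_points :: "real set \<Rightarrow> real set" where
  "density_points E = {x. has_density E 1 x}"

definition density_open :: "real set \<Rightarrow> bool" where
  "density_open E \<longleftrightarrow> E \<in> sets lebesgue \<and> E \<subseteq> density_points E"

definition density_topology :: "real topology" where
  "density_topology = topology density_open"

text \<open>The constant \<^const>\<open>topology\<close> is only meaningful on predicates satisfying
  \<^const>\<open>istopology\<close>; this is shown for \<^const>\<open>density_open\<close> below.\<close>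

lemma measure_split_interval:
  fixes x h :: real
  assumes "E \<in> sets lebesgue" "h > 0"
  shows "measure lebesgue (E \<inter> {x - h..x + h}) = 2 * h - measure lebesgue ({x - h..x + h} - E)"
proof -
  have I: "{x - h..x + h} \<in> lmeasurable" by simp
  have "measure lebesgue ({x - h..x + h} - E)
        = measure lebesgue {x - h..x + h} - measure lebesgue (E \<inter> {x - h..x + h})"
    using measurable_measure_Diff[of "{x - h..x + h}" lebesgue "E \<inter> {x - h..x + h}"] I assms(1)
    by (simp add: Diff_Int)
  then show ?thesis using assms(2) by simp
qed

lemma has_density_1_iff:
  assumes "E \<in> sets lebesgue"
  shows "has_density E 1 x \<longleftrightarrow>
     ((\<lambda>h. measure lebesgue ({x - h..x + h} - E) / (2 * h)) \<longlongrightarrow> 0) (at_right 0)"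
proof -
  let ?f = "\<lambda>h. measure lebesgue (E \<inter> {x - h..x + h}) / (2 * h)"
  let ?g = "\<lambda>h. measure lebesgue ({x - h..x + h} - E) / (2 * h)"
  have pos: "eventually (\<lambda>h::real. h > 0) (at_right 0)"
    by (simp add: eventually_at_right_less)
  have fg: "eventually (\<lambda>h. ?f h = 1 - ?g h) (at_right 0)"
    using pos
  proof eventually_elim
    case (elim h)
    show ?case
      unfolding measure_split_interval[OF assms elim] diff_divide_distrib using elim by simp
  qed
  have "has_density E 1 x \<longleftrightarrow> ((\<lambda>h. 1 - ?g h) \<longlongrightarrow> 1) (at_right 0)"
    unfolding has_density_def by (rule tendsto_cong[OF fg])
  also have "\<dots> \<longleftrightarrow> (?g \<longlongrightarrow> 0) (at_right 0)"
  proof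
    assume "((\<lambda>h. 1 - ?g h) \<longlongrightarrow> 1) (at_right 0)"
    from tendsto_diff[OF tendsto_const[of 1] this] show "(?g \<longlongrightarrow> 0) (at_right 0)" by simp
  next
    assume "(?g \<longlongrightarrow> 0) (at_right 0)"
    from tendsto_diff[OF tendsto_const[of 1] this] show "((\<lambda>h. 1 - ?g h) \<longlongrightarrow> 1) (at_right 0)" by simp
  qed
  finally show ?thesis .
qed

lemma density_open_Int:
  assumes "density_open A" "density_open B"
  shows "density_open (A \<inter> B)"
proof -
  have meas: "A \<in> sets lebesgue" "B \<in> sets lebesgue"
    using assms by (auto simp: density_open_def)
  have "has_density (A \<inter> B) 1 x" if "x \<in> A \<inter> B" for x
  proof -
    let ?g = "\<lambda>E h. measure lebesgue ({x - h..x + h} - E) / (2 * h)"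
    have "(?g A \<longlongrightarrow> 0) (at_right 0)" "(?g B \<longlongrightarrow> 0) (at_right 0)"
      using that assms meas by (auto simp: density_open_def density_points_def has_density_1_iff)
    then have lim: "((\<lambda>h. ?g A h + ?g B h) \<longlongrightarrow> 0) (at_right 0)"
      using tendsto_add by fastforce
    have "(?g (A \<inter> B) \<longlongrightarrow> 0) (at_right 0)"
    proof (rule tendsto_sandwich[OF _ _ tendsto_const lim])
      show "eventually (\<lambda>h. 0 \<le> ?g (A \<inter> B) h) (at_right 0)"
        using eventually_at_right_less[of 0] by eventually_elim simp
      show "eventually (\<lambda>h. ?g (A \<inter> B) h \<le> ?g A h + ?g B h) (at_right 0)"
        using eventually_at_right_less[of 0]
      proof eventually_elim
        case (elim h)
        let ?I = "{x - h..x + h}"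
        have "measure lebesgue (?I - A \<inter> B) = measure lebesgue ((?I - A) \<union> (?I - B))"
          by (simp add: Diff_Int)
        also have "\<dots> \<le> measure lebesgue (?I - A) + measure lebesgue (?I - B)"
          using meas by (intro measure_Un_le) auto
        finally show ?case
          using elim by (simp add: divide_right_mono flip: add_divide_distrib)
      qed
    qed
    then show ?thesis using meas by (simp add: has_density_1_iff)
  qed
  then show ?thesis using meas by (auto simp: density_open_def density_points_def)
qed

lemma density_mono:
  assumes "A \<subseteq> B" "A \<in> sets lebesgue" "B \<in> sets lebesgue" "has_density A 1 x"
  shows "has_density B 1 x"
proof -
  let ?g = "\<lambda>E h. measure lebesgue ({x - h..x + h} - E) / (2 * h)"
  have lim: "(?g A \<longlongrightarrow> 0) (at_right 0)"
    using assms by (simp add: has_density_1_iff)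
  have "(?g B \<longlongrightarrow> 0) (at_right 0)"
  proof (rule tendsto_sandwich[OF _ _ tendsto_const lim])
    show "eventually (\<lambda>h. 0 \<le> ?g B h) (at_right 0)"
      using eventually_at_right_less[of 0] by eventually_elim simp
    show "eventually (\<lambda>h. ?g B h \<le> ?g A h) (at_right 0)"
      using eventually_at_right_less[of 0]
    proof eventually_elim
      case (elim h)
      have "{x - h..x + h} - A \<in> lmeasurable" 
        by (rule fmeasurable_Diff) (use assms(2) in auto)
      then have "measure lebesgue ({x - h..x + h} - B) \<le> measure lebesgue ({x - h..x + h} - A)"
        using assms by (intro measure_mono_fmeasurable) auto
      then show ?case using elim by (simp add: divide_right_mono)
    qed
  qed
  then show ?thesis using assms by (simp add: has_density_1_iff)
qed

lemma measurable_kernel: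
  fixes U :: "real set"
  obtains V where "V \<in> sets lebesgue" "V \<subseteq> U"
    "\<And>F. F \<in> sets lebesgue \<Longrightarrow> F \<subseteq> U \<Longrightarrow> negligible (F - V)"
proof -
  define I where "I n = {- real n..real n}" for n
  define C where "C = {W. W \<in> sets lebesgue \<and> W \<subseteq> U}"
  define M where "M n = (\<lambda>W. measure lebesgue (W \<inter> I n)) ` C" for n
  have Ilm: "W \<inter> I n \<in> lmeasurable" if "W \<in> sets lebesgue" for W n
  proof -
    have "I n \<inter> W \<in> lmeasurable"
      by (rule fmeasurable_Int_fmeasurable[OF _ that]) (simp add: I_def)
    then show ?thesis by (simp only: Int_commute)
  qed
  have "{} \<in> C" by (simp add: C_def)
  then have ne: "M n \<noteq> {}" for n unfolding M_def by blast
  have bdd: "bdd_above (M n)" for n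
  proof (rule bdd_aboveI)
    fix y assume "y \<in> M n"
    then obtain W where W: "W \<in> C" "y = measure lebesgue (W \<inter> I n)" unfolding M_def by blast
    have "W \<inter> I n \<in> sets lebesgue"
      using W(1) Ilm[of W n] by (simp add: C_def fmeasurableD)
    then show "y \<le> measure lebesgue (I n)"
      unfolding W(2) by (rule measure_mono_fmeasurable[OF Int_lower2]) (simp add: I_def)
  qed
  have "\<exists>W\<in>C. measure lebesgue (W \<inter> I n) > Sup (M n) - 1 / Suc k" for n k
  proof -
    have "Sup (M n) - 1 / Suc k < Sup (M n)" by simp
    then obtain y where "y \<in> M n" "Sup (M n) - 1 / Suc k < y"
      by (rule less_cSupE) (rule ne)
    then show ?thesis unfolding M_def by blast
  qed
  then obtain W where WC: "\<And>n k. W n k \<in> C"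
    and W: "\<And>n k. measure lebesgue (W n k \<inter> I n) > Sup (M n) - 1 / Suc k" by metis
  define V where "V = (\<Union>n k. W n k)"
  have VC: "V \<in> sets lebesgue" "V \<subseteq> U"
    using WC by (auto simp: V_def C_def)
  have VM: "measure lebesgue (V \<inter> I n) \<ge> Sup (M n)" for n
  proof (rule field_le_epsilon)
    fix e :: real assume "e > 0"
    then obtain k where k: "1 / Suc k < e" using nat_approx_posE by blast
    have "measure lebesgue (W n k \<inter> I n) \<le> measure lebesgue (V \<inter> I n)"
    proof (rule measure_mono_fmeasurable)
      show "W n k \<inter> I n \<subseteq> V \<inter> I n" unfolding V_def by blast
      show "W n k \<inter> I n \<in> sets lebesgue"
        using WC[of n k] Ilm[of "W n k" n] by (simp add: C_def fmeasurableD)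
      show "V \<inter> I n \<in> lmeasurable" by (rule Ilm[OF VC(1)])
    qed
    with W[of n k] k show "Sup (M n) \<le> measure lebesgue (V \<inter> I n) + e" by linarith
  qed
  have "negligible (F - V)" if F: "F \<in> sets lebesgue" "F \<subseteq> U" for F
  proof -
    have "negligible ((F - V) \<inter> I n)" for n
    proof -
      have FV: "F \<union> V \<in> C" using F VC by (auto simp: C_def)
      then have "measure lebesgue ((F \<union> V) \<inter> I n) \<le> Sup (M n)"
        unfolding M_def by (intro cSup_upper[OF _ bdd[unfolded M_def]] imageI)
      then have le: "measure lebesgue ((F \<union> V) \<inter> I n) \<le> measure lebesgue (V \<inter> I n)"
        using VM[of n] by linarith
      have "measure lebesgue ((F \<union> V) \<inter> I n - V \<inter> I n)
          = measure lebesgue ((F \<union> V) \<inter> I n) - measure lebesgue (V \<inter> I n)"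
        by (rule measurable_measure_Diff) (use Ilm F VC in auto)
      moreover have "(F \<union> V) \<inter> I n - V \<inter> I n = (F - V) \<inter> I n" by auto
      ultimately have "measure lebesgue ((F - V) \<inter> I n) = 0"
        using le measure_nonneg[of lebesgue "(F - V) \<inter> I n"] by simp
      moreover have "(F - V) \<inter> I n \<in> lmeasurable" using F VC by (intro Ilm) auto
      ultimately show ?thesis by (simp add: negligible_iff_measure)
    qed
    then have "negligible (\<Union>n. (F - V) \<inter> I n)" by (intro negligible_countable_Union) auto
    moreover have "(\<Union>n. (F - V) \<inter> I n) = F - V"
    proof -
      have "\<exists>n. x \<in> I n" for x
        using real_arch_simple[of "\<bar>x\<bar>"] by (auto simp: I_def abs_le_iff minus_le_iff)
      then show ?thesis by auto
    qed
    ultimately show ?thesis by simp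
  qed
  with VC show thesis by (rule that)
qed

lemma density_open_Union:
  assumes "\<And>F. F \<in> \<F> \<Longrightarrow> density_open F"
  shows "density_open (\<Union>\<F>)"
proof -
  obtain V where V: "V \<in> sets lebesgue" "V \<subseteq> \<Union>\<F>"
    and ker: "\<And>F. F \<in> sets lebesgue \<Longrightarrow> F \<subseteq> \<Union>\<F> \<Longrightarrow> negligible (F - V)"
    using measurable_kernel[of "\<Union>\<F>"] by metis
  have neg: "negligible (\<Union>\<F> - V)"
    unfolding negligible_eq_zero_density_alt
  proof (intro ballI allI impI)
    fix x and e :: real
    assume x: "x \<in> \<Union>\<F> - V" and e: "0 < e"
    then obtain F where F: "F \<in> \<F>" "x \<in> F" by blast
    then have Fm: "F \<in> sets lebesgue" and "has_density F 1 x"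
      using assms by (auto simp: density_open_def density_points_def)
    then have "((\<lambda>h. measure lebesgue ({x - h..x + h} - F) / (2 * h)) \<longlongrightarrow> 0) (at_right 0)"
      by (simp add: has_density_1_iff)
    then have "eventually (\<lambda>h. measure lebesgue ({x - h..x + h} - F) / (2 * h) < e) (at_right 0)"
      using e by (rule order_tendstoD)
    moreover have "eventually (\<lambda>h. h \<in> {0<..<e}) (at_right 0)"
      using e by (rule eventually_at_right_real)
    ultimately have "eventually (\<lambda>h. 0 < h \<and> h < e \<and>
        measure lebesgue ({x - h..x + h} - F) / (2 * h) < e) (at_right 0)"
      by eventually_elim simp
    then obtain h where h: "0 < h" "h < e"
      "measure lebesgue ({x - h..x + h} - F) / (2 * h) < e"
      using eventually_happens'[of "at_right (0::real)"] trivial_limit_at_right_real by blast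
    define T where "T = ({x - h..x + h} - F) \<union> (F - V)"
    have n: "negligible (F - V)" using ker Fm F by blast
    have IF: "{x - h..x + h} - F \<in> lmeasurable" by (rule fmeasurable_Diff) (use Fm in auto)
    have Tm: "T \<in> lmeasurable" 
      unfolding T_def using IF n by (intro fmeasurable.Un) (auto simp: negligible_iff_measure)
    have "measure lebesgue T \<le> measure lebesgue ({x - h..x + h} - F) + measure lebesgue (F - V)"
      unfolding T_def using IF n by (intro measure_Un_le) (auto simp: negligible_iff_measure fmeasurableD)
    also have "\<dots> = measure lebesgue ({x - h..x + h} - F)"
      using n by (simp add: negligible_iff_measure)
    also have "\<dots> < e * (2 * h)" using h by (simp add: pos_divide_less_eq)
    also have "2 * h = measure lebesgue (ball x h)" using h by (simp add: ball_eq_greaterThanLessThan)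
    finally have "measure lebesgue T < e * measure lebesgue (ball x h)" .
    moreover have "(\<Union>\<F> - V) \<inter> ball x h \<subseteq> T"
      by (auto simp: T_def dist_real_def)
    ultimately show "\<exists>d U. 0 < d \<and> d \<le> e \<and> (\<Union>\<F> - V) \<inter> ball x d \<subseteq> U \<and>
        U \<in> lmeasurable \<and> measure lebesgue U < e * measure lebesgue (ball x d)"
      using h Tm by (intro exI[of _ h] exI[of _ T]) simp
  qed
  have "V \<union> (\<Union>\<F> - V) \<in> sets lebesgue"
    using V neg by (intro sets.Un) (auto simp: negligible_imp_sets)
  moreover have "V \<union> (\<Union>\<F> - V) = \<Union>\<F>" using V by auto
  ultimately have Um: "\<Union>\<F> \<in> sets lebesgue" by simp
  have "has_density (\<Union>\<F>) 1 x" if "x \<in> \<Union>\<F>" for x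
  proof -
    from that obtain F where F: "F \<in> \<F>" "x \<in> F" by blast
    with assms have "F \<in> sets lebesgue" "has_density F 1 x"
      by (auto simp: density_open_def density_points_def)
    then show ?thesis using density_mono[of F "\<Union>\<F>" x] F Um by blast
  qed
  with Um show ?thesis by (auto simp: density_open_def density_points_def)
qed

lemma istopology_density_open: "istopology density_open"
  unfolding istopology_def using density_open_Int density_open_Union by blast

lemma openin_density_topology: "openin density_topology E \<longleftrightarrow> density_open E"
  by (simp add: density_topology_def istopology_density_open topology_inverse')

lemma topspace_density_topology [simp]: "topspace density_topology = UNIV"
proof -
  have "has_density UNIV 1 x" for x
    by (simp add: has_density_1_iff)
  then have "openin density_topology UNIV"
    by (auto simp: openin_density_topology density_open_def density_points_def)
  then show ?thesis using openin_subset by blast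
qed

section \<open>Semi-stratifiable and stratifiable spaces\<close>

text \<open>\<open>F U n\<close> is the \<open>n\<close>-th closed set assigned to the open set \<open>U\<close>; the values of \<open>F\<close> on
  sets that are not open are irrelevant.\<close>

definition semi_stratification :: "'a topology \<Rightarrow> ('a set \<Rightarrow> nat \<Rightarrow> 'a set) \<Rightarrow> bool" where
  "semi_stratification X F \<longleftrightarrow>
     (\<forall>U. openin X U \<longrightarrow> (\<forall>n. closedin X (F U n)) \<and> U = (\<Union>n. F U n)) \<and>
     (\<forall>U V. openin X U \<and> openin X V \<and> U \<subseteq> V \<longrightarrow> (\<forall>n. F U n \<subseteq> F V n))"

definition semi_stratifiable_space :: "'a topology \<Rightarrow> bool" where
  "semi_stratifiable_space X \<longleftrightarrow> (\<exists>F. semi_stratification X F)"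

text \<open>As usual, stratifiable spaces are required to be T1; for semi-stratifiability no separation
  axiom is imposed.\<close>

definition stratifiable_space :: "'a topology \<Rightarrow> bool" where
  "stratifiable_space X \<longleftrightarrow> t1_space X \<and>
     (\<exists>F. semi_stratification X F \<and> (\<forall>U. openin X U \<longrightarrow> U = (\<Union>n. X interior_of (F U n))))"

definition closed_discrete_in :: "'a topology \<Rightarrow> 'a set \<Rightarrow> bool" where
  "closed_discrete_in X A \<longleftrightarrow> closedin X A \<and> subtopology X A = discrete_topology A"

end

theory Submission
  imports Defs
begin

text \<open>Suppose \<open>A\<close> is semi-stratifiable by \<open>F\<close>. The sets \<open>A - F (A - {y}) n\<close> are neighbourhoods
  of \<open>y\<close>, and by monotonicity they miss \<open>F U n\<close> whenever \<open>U\<close> is open and \<open>y \<notin> U\<close>. For each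
  \<open>n\<close>, countably many of them cover almost all of \<open>A\<close>; collect their centres for all \<open>n\<close> in a
  countable set \<open>C\<close>. Null sets are closed, so \<open>A - C\<close> is open, and all the sets \<open>F (A - C) n\<close> are
  null. Hence \<open>A\<close> is null, so all its subsets are closed.\<close>

lemma density_open_Compl_negligible:
  assumes "negligible N"
  shows "density_open (- N)"
proof -
  have N: "N \<in> sets lebesgue" using assms by (rule negligible_imp_sets)
  then have m: "- N \<in> sets lebesgue" by (simp add: Compl_in_sets_lebesgue)
  have "measure lebesgue ({x - h..x + h} - - N) = 0" for x h
  proof -
    have "negligible ({x - h..x + h} - - N)"
      by (rule negligible_subset[OF assms]) auto
    then show ?thesis by (simp add: negligible_iff_measure)
  qed
  with m show ?thesis
    by (auto simp: density_open_def density_points_def has_density_1_iff)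
qed

lemma negligible_closed_discrete:
  assumes "negligible A"
  shows "closed_discrete_in density_topology A"
proof -
  have c: "closedin density_topology B" if "B \<subseteq> A" for B
    using density_open_Compl_negligible[OF negligible_subset[OF assms that]]
    by (simp add: closedin_def openin_density_topology Compl_eq_Diff_UNIV)
  have "openin (subtopology density_topology A) S \<longleftrightarrow> S \<subseteq> A" for S
  proof
    show "S \<subseteq> A" if "openin (subtopology density_topology A) S"
      using openin_subset[OF that] by simp
    assume "S \<subseteq> A"
    \<comment> \<open>The complement of the null set \<open>A - S\<close> is an open subset of the
      line whose trace on \<open>A\<close> is \<open>S\<close>.\<close>
    moreover have "density_open (- (A - S))"
      by (intro density_open_Compl_negligible negligible_subset[OF assms]) auto
    ultimately show "openin (subtopology density_topology A) S"
      unfolding openin_subtopology openin_density_topology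
      by (intro exI[of _ "- (A - S)"]) auto
  qed
  then have "subtopology density_topology A = discrete_topology A"
    by (simp add: topology_eq)
  with c show ?thesis by (simp add: closed_discrete_in_def)
qed

text \<open>Uncountably many \<open>U\<close> may occur, so their null traces cannot simply be
  united. Instead, \<open>U\<close> has density 1 at \<open>x\<close> and
  \<open>U \<inter> S\<close> is null, so \<open>S\<close> has outer density 0 at each of its
  points. This forces \<open>S\<close> to be null even if it is not known to be measurable.\<close>

lemma locally_negligible_imp_negligible:
  assumes "\<And>x. x \<in> S \<Longrightarrow> \<exists>U. density_open U \<and> x \<in> U \<and> negligible (U \<inter> S)"
  shows "negligible S"
  unfolding negligible_eq_zero_density_alt
proof (intro ballI allI impI)
  fix x e :: real
  assume "x \<in> S" and e: "0 < e"
  then obtain U where U: "density_open U" "x \<in> U" and n: "negligible (U \<inter> S)"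
    using assms by blast
  then have Um: "U \<in> sets lebesgue" and "has_density U 1 x"
    by (auto simp: density_open_def density_points_def)
  then have "((\<lambda>h. measure lebesgue ({x - h..x + h} - U) / (2 * h)) \<longlongrightarrow> 0) (at_right 0)"
    by (simp add: has_density_1_iff)
  then have "eventually (\<lambda>h. measure lebesgue ({x - h..x + h} - U) / (2 * h) < e) (at_right 0)"
    using e by (rule order_tendstoD)
  moreover have "eventually (\<lambda>h. h \<in> {0<..<e}) (at_right 0)"
    using e by (rule eventually_at_right_real)
  ultimately have "eventually (\<lambda>h. h \<in> {0<..<e} \<and>
      measure lebesgue ({x - h..x + h} - U) / (2 * h) < e) (at_right 0)"
    by eventually_elim simp
  then have "\<exists>h. h \<in> {0<..<e} \<and> measure lebesgue ({x - h..x + h} - U) / (2 * h) < e"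
    by (rule eventually_happens'[OF trivial_limit_at_right_real])
  then obtain h where h: "0 < h" "h < e"
    "measure lebesgue ({x - h..x + h} - U) / (2 * h) < e"
    by auto
  \<comment> \<open>A measurable cover of \<open>S\<close> near \<open>x\<close>: the small part of
    the interval outside \<open>U\<close>, and a null set.\<close>
  define T where "T = ({x - h..x + h} - U) \<union> (U \<inter> S)"
  have I: "{x - h..x + h} - U \<in> lmeasurable"
    by (rule fmeasurable_Diff) (use Um in auto)
  have n': "U \<inter> S \<in> lmeasurable" "measure lebesgue (U \<inter> S) = 0"
    using n by (auto simp: negligible_iff_measure)
  have Tm: "T \<in> lmeasurable"
    unfolding T_def using I n'(1) by (rule fmeasurable.Un)
  have "measure lebesgue T \<le> measure lebesgue ({x - h..x + h} - U)"
    using measure_Un_le[OF fmeasurableD[OF I] fmeasurableD[OF n'(1)]] n'(2)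
    by (simp add: T_def)
  also have "\<dots> < e * measure lebesgue (ball x h)"
    using h by (simp add: pos_divide_less_eq ball_eq_greaterThanLessThan)
  finally have "measure lebesgue T < e * measure lebesgue (ball x h)" .
  moreover have "S \<inter> ball x h \<subseteq> T"
    by (auto simp: T_def dist_real_def)
  ultimately show "\<exists>d U. 0 < d \<and> d \<le> e \<and> S \<inter> ball x d \<subseteq> U \<and>
      U \<in> lmeasurable \<and> measure lebesgue U < e * measure lebesgue (ball x d)"
    using h Tm by (intro exI[of _ h] exI[of _ T] conjI) simp_all
qed

text \<open>Exhaustion: among countable unions of the \<open>G i\<close> one has the largest
  measure, and adjoining one more \<open>G i\<close> cannot enlarge it.\<close>

lemma (in finite_measure) countable_essential_Union:
  assumes "\<And>i. i \<in> I \<Longrightarrow> G i \<in> sets M"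
  obtains C where "countable C" "C \<subseteq> I"
    "\<And>i. i \<in> I \<Longrightarrow> G i - (\<Union>j\<in>C. G j) \<in> null_sets M"
proof -
  let ?\<C> = "{C. countable C \<and> C \<subseteq> I}"
  let ?U = "\<lambda>C. \<Union>j\<in>C. G j"
  let ?s = "SUP C\<in>?\<C>. emeasure M (?U C)"
  have Um: "?U C \<in> sets M" if "C \<in> ?\<C>" for C
    using that assms by (intro sets.countable_UN'') auto
  have "{} \<in> ?\<C>" by simp
  then have "?\<C> \<noteq> {}" by blast
  from ennreal_SUP_countable_SUP[OF this, of "\<lambda>C. emeasure M (?U C)"]
  obtain f :: "nat \<Rightarrow> ennreal"
    where f: "range f \<subseteq> (\<lambda>C. emeasure M (?U C)) ` ?\<C>" "?s = (SUP n. f n)"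
    by blast
  have "\<exists>C. C \<in> ?\<C> \<and> f n = emeasure M (?U C)" for n
    using f(1) by blast
  then obtain D where D: "\<And>n. D n \<in> ?\<C>" "\<And>n. f n = emeasure M (?U (D n))"
    by metis
  \<comment> \<open>Uniting a maximizing sequence of countable index sets gives a countable index
    set, so the supremum is attained.\<close>
  define C where "C = (\<Union>n. D n)"
  have C: "C \<in> ?\<C>" using D(1) by (auto simp: C_def)
  have s: "?s \<le> emeasure M (?U C)"
    unfolding f(2)
  proof (rule SUP_least)
    fix n
    have "?U (D n) \<subseteq> ?U C" by (auto simp: C_def)
    then show "f n \<le> emeasure M (?U C)"
      unfolding D(2) using Um[OF C] by (rule emeasure_mono)
  qed
  have "G i - ?U C \<in> null_sets M" if i: "i \<in> I" for i
  proof -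
    have iC: "insert i C \<in> ?\<C>" using C i by simp
    have "emeasure M (?U (insert i C)) \<le> ?s" using iC by (rule SUP_upper)
    then have le: "emeasure M (?U (insert i C)) \<le> emeasure M (?U C)"
      using s by (rule order_trans)
    have "emeasure M (?U C) + emeasure M (G i - ?U C) = emeasure M (?U (insert i C))"
      using Um[OF C] assms[OF i]
      by (subst plus_emeasure) (auto intro: arg_cong[where f = "emeasure M"])
    with le have "emeasure M (?U C) + emeasure M (G i - ?U C) \<le> emeasure M (?U C) + 0"
      by simp
    \<comment> \<open>Finiteness of the measure permits the cancellation.\<close>
    then have "emeasure M (G i - ?U C) = 0"
      using ennreal_add_left_cancel_le[of "emeasure M (?U C)" "emeasure M (G i - ?U C)" 0]
        emeasure_finite[of "?U C"] by (auto simp: top_unique)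
    then show ?thesis using Um[OF C] assms[OF i] by (auto simp: null_sets_def)
  qed
  with C show thesis using that by blast
qed

text \<open>Lebesgue measure is infinite, so the finite case is applied on each interval
  \<open>[-n, n]\<close>; the union of the resulting index sets is still countable.\<close>

lemma lebesgue_countable_essential_Union:
  fixes G :: "'i \<Rightarrow> real set"
  assumes "\<And>i. i \<in> I \<Longrightarrow> G i \<in> sets lebesgue"
  obtains C where "countable C" "C \<subseteq> I"
    "\<And>i. i \<in> I \<Longrightarrow> negligible (G i - (\<Union>j\<in>C. G j))"
proof -
  have "\<exists>C. countable C \<and> C \<subseteq> I \<and>
      (\<forall>i\<in>I. negligible ((G i - (\<Union>j\<in>C. G j)) \<inter> {- real n..real n}))" for n
  proof -
    let ?J = "{- real n..real n}"
    interpret finite_measure "lebesgue_on ?J"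
      by (rule finite_measure_lebesgue_on) simp
    have m: "G i \<inter> ?J \<in> sets (lebesgue_on ?J)" if "i \<in> I" for i
      using assms[OF that] by (auto simp: sets_restrict_space)
    obtain C where "countable C" "C \<subseteq> I"
      and C: "\<And>i. i \<in> I \<Longrightarrow> G i \<inter> ?J - (\<Union>j\<in>C. G j \<inter> ?J) \<in> null_sets (lebesgue_on ?J)"
      using countable_essential_Union[of I "\<lambda>i. G i \<inter> ?J"] m by blast
    moreover have "negligible ((G i - (\<Union>j\<in>C. G j)) \<inter> ?J)" if "i \<in> I" for i
    proof -
      have "G i \<inter> ?J - (\<Union>j\<in>C. G j \<inter> ?J) = (G i - (\<Union>j\<in>C. G j)) \<inter> ?J" by auto
      then show ?thesis
        using C[OF that] by (simp add: null_sets_restrict_space negligible_iff_null_sets)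
    qed
    ultimately show ?thesis by blast
  qed
  then obtain C where C: "\<And>n. countable (C n)" "\<And>n. C n \<subseteq> I"
    "\<And>n i. i \<in> I \<Longrightarrow> negligible ((G i - (\<Union>j\<in>C n. G j)) \<inter> {- real n..real n})"
    by metis
  have "negligible (G i - (\<Union>j\<in>(\<Union>n. C n). G j))" if "i \<in> I" for i
  proof (rule negligible_subset)
    show "negligible (\<Union>n. (G i - (\<Union>j\<in>C n. G j)) \<inter> {- real n..real n})"
      using C(3)[OF that] by (intro negligible_countable_Union) auto
    show "G i - (\<Union>j\<in>(\<Union>n. C n). G j) \<subseteq>
        (\<Union>n. (G i - (\<Union>j\<in>C n. G j)) \<inter> {- real n..real n})"
    proof
      fix x assume x: "x \<in> G i - (\<Union>j\<in>(\<Union>n. C n). G j)"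
      obtain n where "\<bar>x\<bar> \<le> real n" using real_arch_simple by blast
      then have "x \<in> (G i - (\<Union>j\<in>C n. G j)) \<inter> {- real n..real n}" using x by auto
      then show "x \<in> (\<Union>n. (G i - (\<Union>j\<in>C n. G j)) \<inter> {- real n..real n})" by (rule UN_I[OF UNIV_I])
    qed
  qed
  then show thesis using that[of "\<Union>n. C n"] C(1,2) by blast
qed

lemma semi_stratifiable_imp_negligible:
  assumes "semi_stratifiable_space (subtopology density_topology A)"
  shows "negligible A"
proof -
  let ?X = "subtopology density_topology A"
  obtain F where "semi_stratification ?X F"
    using assms by (auto simp: semi_stratifiable_space_def)
  then have F: "\<forall>U. openin ?X U \<longrightarrow> (\<forall>n. closedin ?X (F U n)) \<and> U = (\<Union>n. F U n)"
    and mono: "\<And>U V n. openin ?X U \<Longrightarrow> openin ?X V \<Longrightarrow> U \<subseteq> V \<Longrightarrow> F U n \<subseteq> F V n"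
    unfolding semi_stratification_def by simp_all
  have closed: "closedin ?X (F U n)" if "openin ?X U" for U n
    using F that by simp
  have cover: "x \<in> U \<longleftrightarrow> (\<exists>n. x \<in> F U n)" if "openin ?X U" for U x
  proof -
    have "U = (\<Union>n. F U n)" using F that by simp
    then have "x \<in> U \<longleftrightarrow> x \<in> (\<Union>n. F U n)" by (rule arg_cong)
    then show ?thesis by simp
  qed
  have opn: "openin ?X (A - N)" if "negligible N" for N
    using density_open_Compl_negligible[OF that]
    by (auto simp: openin_subtopology openin_density_topology)
  \<comment> \<open>\<open>A\<close> may be nonmeasurable, so its relatively open subsets are
    represented as traces of open sets \<open>W\<close>, which are measurable as the essential union
    requires.\<close>
  have ex: "\<exists>W. density_open W \<and> A - F (A - {y}) n = W \<inter> A" for y n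
    using openin_diff[OF openin_topspace closed[OF opn[of "{y}"]]]
    by (auto simp: openin_subtopology openin_density_topology)
  have "\<exists>W. \<forall>n y. density_open (W n y) \<and> A - F (A - {y}) n = W n y \<inter> A"
    by (rule choice, rule allI, rule choice, rule allI, rule ex)
  then obtain W where W: "\<And>y n. density_open (W n y)"
    "\<And>y n. A - F (A - {y}) n = W n y \<inter> A" by blast
  \<comment> \<open>The sets \<open>F (A - {y}) n\<close> have union \<open>A - {y}\<close>, so none
    of them contains \<open>y\<close>.\<close>
  have yW: "y \<in> W n y" if "y \<in> A" for y n
    using cover[OF opn[of "{y}"], of y] W(2)[of y n] that by auto
  have "\<exists>C. countable C \<and> C \<subseteq> A \<and> (\<forall>x\<in>A. negligible (W n x - (\<Union>y\<in>C. W n y)))" for n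
    using lebesgue_countable_essential_Union[of A "W n"] W(1)
    unfolding density_open_def by metis
  then obtain C where C: "\<And>n. countable (C n)" "\<And>n. C n \<subseteq> A"
    "\<And>n x. x \<in> A \<Longrightarrow> negligible (W n x - (\<Union>y\<in>C n. W n y))" by metis
  define K where "K = (\<Union>n. C n)"
  have K: "negligible K" using C(1) by (simp add: K_def countable_imp_null_set_lborel negligible_iff_null_sets null_sets_completionI)
  \<comment> \<open>Around a point \<open>x\<close> of the remainder, \<open>W n x\<close> is an
    open neighbourhood that meets the remainder in a null set, by the choice of
    \<open>C n\<close>.\<close>
  have N: "negligible (A - (\<Union>y\<in>C n. W n y))" for n
  proof (rule locally_negligible_imp_negligible)
    fix x assume x: "x \<in> A - (\<Union>y\<in>C n. W n y)"
    then have "negligible (W n x \<inter> (A - (\<Union>y\<in>C n. W n y)))"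
      by (intro negligible_subset[OF C(3)[of x n]]) auto
    then show "\<exists>U. density_open U \<and> x \<in> U \<and> negligible (U \<inter> (A - (\<Union>y\<in>C n. W n y)))"
      using W(1) yW x by blast
  qed
  \<comment> \<open>Since \<open>K\<close> contains the centres of every level, \<open>A - K\<close>
    lies in \<open>A - {y}\<close> for all \<open>y \<in> C n\<close>; monotonicity puts
    \<open>F (A - K) n\<close> inside \<open>F (A - {y}) n\<close>, which misses
    \<open>W n y\<close>.\<close>
  have sub: "F (A - K) n \<subseteq> A - (\<Union>y\<in>C n. W n y)" for n
  proof
    fix x assume x: "x \<in> F (A - K) n"
    then have xA: "x \<in> A" using cover[OF opn[OF K]] by blast
    moreover have "x \<notin> W n y" if "y \<in> C n" for y
    proof -
      have "A - K \<subseteq> A - {y}" using that by (auto simp: K_def)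
      then have "x \<in> F (A - {y}) n" using mono[OF opn[OF K] opn[of "{y}"]] x by auto
      then show ?thesis using W(2)[of y n] xA by blast
    qed
    ultimately show "x \<in> A - (\<Union>y\<in>C n. W n y)" by blast
  qed
  \<comment> \<open>The sets \<open>F (A - K) n\<close> exhaust \<open>A - K\<close>, so countably
    many null remainders cover \<open>A\<close> outside the null set \<open>K\<close>.\<close>
  have "A - K \<subseteq> (\<Union>n. A - (\<Union>y\<in>C n. W n y))"
  proof
    fix x assume "x \<in> A - K"
    then obtain n where "x \<in> F (A - K) n" using iffD1[OF cover[OF opn[OF K]]] by metis
    then have "x \<in> A - (\<Union>y\<in>C n. W n y)" by (rule subsetD[OF sub])
    then show "x \<in> (\<Union>n. A - (\<Union>y\<in>C n. W n y))" by (rule UN_I[OF UNIV_I])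
  qed
  then have "A \<subseteq> K \<union> (\<Union>n. A - (\<Union>y\<in>C n. W n y))"
    by (simp only: Diff_subset_conv)
  moreover have "negligible (\<Union>n. A - (\<Union>y\<in>C n. W n y))"
    using N by (intro negligible_countable_Union) auto
  ultimately show ?thesis using negligible_subset[OF negligible_Un[OF K]] by metis
qed

text \<open>Every subset is clopen, so the constant sequence at \<open>U\<close> stratifies
  \<open>U\<close>.\<close>

lemma stratifiable_discrete_topology: "stratifiable_space (discrete_topology A)"
proof -
  have "t1_space (discrete_topology A)"
    by (simp add: Hausdorff_imp_t1_space)
  moreover have "semi_stratification (discrete_topology A) (\<lambda>U n. U)"
    by (simp add: semi_stratification_def)
  moreover have "discrete_topology A interior_of U = U" if "U \<subseteq> A" for U
    using that by (simp add: interior_of_openin Int_absorb1)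
  ultimately show ?thesis
    unfolding stratifiable_space_def by (intro conjI exI[of _ "\<lambda>U n. U"]) simp_all
qed

theorem corollary2p2:
  shows "\<not> semi_stratifiable_space density_topology \<and>
    (\<forall>A. stratifiable_space (subtopology density_topology A) \<longleftrightarrow>
         closed_discrete_in density_topology A)"
proof (intro conjI allI iffI)
  show "\<not> semi_stratifiable_space density_topology"
    \<comment> \<open>The subspace on \<open>UNIV\<close> is the whole space, and the line is not
      null.\<close>
    using semi_stratifiable_imp_negligible[of UNIV] by auto
next
  fix A assume "stratifiable_space (subtopology density_topology A)"
  then have "semi_stratifiable_space (subtopology density_topology A)"
    unfolding stratifiable_space_def semi_stratifiable_space_def by blast
  then show "closed_discrete_in density_topology A"
    by (intro negligible_closed_discrete semi_stratifiable_imp_negligible)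
next
  fix A assume "closed_discrete_in density_topology A"
  then show "stratifiable_space (subtopology density_topology A)"
    by (simp add: closed_discrete_in_def stratifiable_discrete_topology)
qed

end
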